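(* Let $n_1,n_2,n_3$ be positive integers and let $M=M(n_1,n_2,n_3)$ be the largest integer for which there exist four pairwise disjoint subsets $J,K_1,K_2,K_3$ of $[n_1]\times[n_2]\times[n_3]$, each of cardinality $M$, together with bijections $s_i:J\to K_i$ ($i=1,2,3$) such that $s_i$ fixes the $i$-th component (i.e. if $s_i(j_1,j_2,j_3)=(k_1,k_2,k_3)$ then $k_i=j_i$). Assume $M\ge1$. Let $$T_1=\sum_{i_1=0}^{n_1}\sum_{i_2=0}^{n_2}\sum_{i_3=0}^{n_3} v^1_{i_1}\otimes v^2_{i_2}\otimes v^3_{i_3}\otimes v^4_{i_1,i_2,i_3}\in V_1\otimes V_2\otimes V_3\otimes V_4,$$ where $V_p=\mathbb{C}^{n_p+1}$ has basis $\{v^p_i:0\le i\le n_p\}$ for $p=1,2,3$, and $V_4=\mathbb{C}^{(n_1+1)(n_2+1)(n_3+1)}$ has basis $\{v^4_{i_1,i_2,i_3}:0\le i_p\le n_p\}$. Let $$T_2=\sum_{\ell=1}^{M} w^1_\ell\otimes w^2_\ell\otimes w^3_\ell\otimes w^4\in W_1\otimes W_2\otimes W_3\otimes W_4,$$ where $W_p=\mathbb{C}^M$ has basis $\{w^p_\ell:1\le\ell\le M\}$ for $p=1,2,3$, and $W_4=\mathbb{C}^1$ is spanned by $w^4$. Then $$\underline{\mathrm{R}}(T_1)=(n_1+1)(n_2+1)(n_3+1),\qquad \underline{\mathrm{R}}(T_2)=M,$$ and $$\underline{\mathrm{R}}(T_1\oplus T_2)=(n_1+1)(n_2+1)(n_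3+1)+1.$$
   Context: Here $[n]=\{1,\dots,n\}$. All vector spaces are finite dimensional over $\mathbb{C}$. For a tensor $T\in V_1\otimes\cdots\otimes V_k$, the tensor rank $\mathrm{R}(T)$ is the least $r$ such that $T=\sum_{i=1}^r v_1^{(i)}\otimes\cdots\otimes v_k^{(i)}$ with $v_j^{(i)}\in V_j$. The border rank $\underline{\mathrm{R}}(T)$ is the least $r$ such that $T=\lim_{\varepsilon\to0}T_\varepsilon$ (Euclidean topology) for tensors $T_\varepsilon\in V_1\otimes\cdots\otimes V_k$ with $\mathrm{R}(T_\varepsilon)=r$ for $\varepsilon\ne0$. For $T\in V_1\otimes\cdots\otimes V_k$ and $S\in W_1\otimes\cdots\otimes W_k$, the direct sum $T\oplus S$ is the tensor $T+S\in (V_1\oplus W_1)\otimes\cdots\otimes(V_k\oplus W_k)$, where $V_j,W_j$ are regarded as the two summands of $V_j\oplus W_j$. *)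

theory Defs
  imports Complex_Main
begin

text \<open>
  For a finite index set \<open>A\<close>, the space \<open>\<complex>\<^sup>A\<close> is modelled by the complex-valued functions
  vanishing outside \<open>A\<close>.  With \<open>V\<^sub>1 = \<complex>\<^sup>A\<close>, ..., \<open>V\<^sub>4 = \<complex>\<^sup>D\<close>, the tensor product
  \<open>V\<^sub>1 \<otimes> V\<^sub>2 \<otimes> V\<^sub>3 \<otimes> V\<^sub>4\<close> is \<open>\<complex>\<^sup>X\<close> for \<open>X = A \<times> B \<times> C \<times> D\<close>, a tensor being given by its
  coordinates in the basis of tensor products of standard basis vectors.
\<close>

definition coord_space :: "'a set \<Rightarrow> ('a \<Rightarrow> complex) set" where
  "coord_space A = {v. \<forall>i. i \<notin> A \<longrightarrow> v i = 0}"

definition basis_vec :: "'a \<Rightarrow> 'a \<Rightarrow> complex" where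
  "basis_vec i = (\<lambda>j. if j = i then 1 else 0)"

definition pure_tensor ::
  "('a \<Rightarrow> complex) \<Rightarrow> ('b \<Rightarrow> complex) \<Rightarrow> ('c \<Rightarrow> complex) \<Rightarrow> ('d \<Rightarrow> complex)
    \<Rightarrow> 'a \<times> 'b \<times> 'c \<times> 'd \<Rightarrow> complex" where
  "pure_tensor u v w z = (\<lambda>(a, b, c, d). u a * v b * w c * z d)"

definition tensor_rank ::
  "'a set \<Rightarrow> 'b set \<Rightarrow> 'c set \<Rightarrow> 'd set \<Rightarrow> ('a \<times> 'b \<times> 'c \<times> 'd \<Rightarrow> complex) \<Rightarrow> nat" where
  "tensor_rank A B C D T = (LEAST r. \<exists>u v w z.
     (\<forall>i<r. u i \<in> coord_space A \<and> v i \<in> coord_space B \<and>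
            w i \<in> coord_space C \<and> z i \<in> coord_space D) \<and>
     T = (\<lambda>x. \<Sum>i<r. pure_tensor (u i) (v i) (w i) (z i) x))"

text \<open>
  All index sets are finite in use, so convergence in the Euclidean topology is convergence of
  every coordinate.  The parameter \<open>\<epsilon>\<close> is complex.
\<close>

definition border_rank ::
  "'a set \<Rightarrow> 'b set \<Rightarrow> 'c set \<Rightarrow> 'd set \<Rightarrow> ('a \<times> 'b \<times> 'c \<times> 'd \<Rightarrow> complex) \<Rightarrow> nat" where
  "border_rank A B C D T = (LEAST r. \<exists>F :: complex \<Rightarrow> 'a \<times> 'b \<times> 'c \<times> 'd \<Rightarrow> complex.
     (\<forall>\<epsilon>. \<epsilon> \<noteq> 0 \<longrightarrow> F \<epsilon> \<in> coord_space (A \<times> B \<times> C \<times> D) \<and> tensor_rank A B C D (F \<epsilon>) = r) \<and>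
     (\<forall>x. ((\<lambda>\<epsilon>. F \<epsilon> x) \<longlongrightarrow> T x) (at 0)))"

text \<open>
  The direct sum of \<open>\<complex>\<^sup>A\<close> and \<open>\<complex>\<^sup>B\<close> is \<open>\<complex>\<^sup>X\<close> for the disjoint union \<open>X = A <+> B\<close>.  In these
  coordinates \<open>T \<oplus> S\<close> is block diagonal.
\<close>

definition tensor_dsum ::
  "('a \<times> 'b \<times> 'c \<times> 'd \<Rightarrow> complex) \<Rightarrow> ('e \<times> 'f \<times> 'g \<times> 'h \<Rightarrow> complex)
    \<Rightarrow> ('a + 'e) \<times> ('b + 'f) \<times> ('c + 'g) \<times> ('d + 'h) \<Rightarrow> complex" where
  "tensor_dsum T S = (\<lambda>x. case x of
       (Inl a, Inl b, Inl c, Inl d) \<Rightarrow> T (a, b, c, d)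
     | (Inr a, Inr b, Inr c, Inr d) \<Rightarrow> S (a, b, c, d)
     | _ \<Rightarrow> 0)"

definition admissible :: "nat \<Rightarrow> nat \<Rightarrow> nat \<Rightarrow> nat \<Rightarrow> bool" where
  "admissible n1 n2 n3 m \<longleftrightarrow>
    (\<exists>J K1 K2 K3 :: (nat \<times> nat \<times> nat) set. \<exists>s1 s2 s3.
       J \<subseteq> {1..n1} \<times> {1..n2} \<times> {1..n3} \<and> K1 \<subseteq> {1..n1} \<times> {1..n2} \<times> {1..n3} \<and>
       K2 \<subseteq> {1..n1} \<times> {1..n2} \<times> {1..n3} \<and> K3 \<subseteq> {1..n1} \<times> {1..n2} \<times> {1..n3} \<and>
       J \<inter> K1 = {} \<and> J \<inter> K2 = {} \<and> J \<inter> K3 = {} \<and>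
       K1 \<inter> K2 = {} \<and> K1 \<inter> K3 = {} \<and> K2 \<inter> K3 = {} \<and>
       card J = m \<and> card K1 = m \<and> card K2 = m \<and> card K3 = m \<and>
       bij_betw s1 J K1 \<and> bij_betw s2 J K2 \<and> bij_betw s3 J K3 \<and>
       (\<forall>j\<in>J. fst (s1 j) = fst j) \<and>
       (\<forall>j\<in>J. fst (snd (s2 j)) = fst (snd j)) \<and>
       (\<forall>j\<in>J. snd (snd (s3 j)) = snd (snd j)))"

text \<open>
  The maximum exists: \<open>m = 0\<close> is always admissible, and admissible \<open>m\<close> are at most \<open>n1 * n2 * n3\<close>.
\<close>

definition max_admissible :: "nat \<Rightarrow> nat \<Rightarrow> nat \<Rightarrow> nat" where
  "max_admissible n1 n2 n3 = (GREATEST m. admissible n1 n2 n3 m)"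

end

theory Submission
  imports Defs
begin

text \<open>
  Lower bounds.  Group the four tensor factors into two.  A tensor of rank at most \<open>r\<close> becomes a
  matrix of rank at most \<open>r\<close>, and a matrix close to the identity is invertible.  Hence a tensor
  whose flattening contains an \<open>m \<times> m\<close> identity block has border rank at least \<open>m\<close>.
  Such a block has size \<open>N = (n1 + 1) (n2 + 1) (n3 + 1)\<close> for \<open>T1\<close> (split off the fourth factor),
  size \<open>M\<close> for \<open>T2\<close> (split off the first factor), and size \<open>N + 1\<close> for the direct sum (split off
  the fourth factor again; one nonzero coordinate of \<open>T2\<close> provides the additional row).  Since
  \<open>T1\<close> and \<open>T2\<close> are by definition sums of \<open>N\<close> and \<open>M\<close> pure tensors, only the upper bound for the
  direct sum is left.

  The degeneration.  Write \<open>e\<^sub>t\<close> for the basis vectors of the first three factors of \<open>T1\<close>, \<open>u\<^sub>i\<close>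
  for those of its fourth factor, \<open>w\<^sub>l\<close> for the basis vectors of the first three factors of \<open>T2\<close>
  and \<open>u\<close> for the vector spanning its fourth factor.  With suitable combinations
  \<open>x\<^sub>i, y\<^sub>i, z\<^sub>i\<close> of the \<open>w\<^sub>l\<close>, where \<open>i = (i1, i2, i3)\<close>, consider the \<open>N + 1\<close> pure tensors
  in
    \<open>\<Sum>i. (e\<^bsub>i1\<^esub> + \<epsilon> x\<^sub>i) \<otimes> (e\<^bsub>i2\<^esub> + \<epsilon> y\<^sub>i) \<otimes> (e\<^bsub>i3\<^esub> + \<epsilon> z\<^sub>i) \<otimes> (u\<^sub>i + u / \<epsilon> ^ 3)
       - (\<Sum>t. e\<^sub>t) \<otimes> (\<Sum>t. e\<^sub>t) \<otimes> (\<Sum>t. e\<^sub>t) \<otimes> u / \<epsilon> ^ 3\<close>.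
  The terms with \<open>u\<^sub>i\<close> tend to \<open>T1\<close>.  The coefficient of \<open>u / \<epsilon> ^ 3\<close> is a cubic polynomial in \<open>\<epsilon>\<close>
  whose constant term cancels, because the sum of \<open>e \<otimes> e \<otimes> e\<close> over a full box is itself a pure
  tensor.  The sum tends to \<open>T1 \<oplus> T2\<close> once the terms of order one and two vanish and the cubic
  term is \<open>\<Sum>l. w\<^sub>l \<otimes> w\<^sub>l \<otimes> w\<^sub>l\<close>; this is \<open>expansion\<close>.

  The choice of the perturbations.  Let \<open>p l\<close> be the \<open>l\<close>-th point of \<open>J\<close> and
  \<open>q1 l, q2 l, q3 l\<close> its partners in \<open>K1, K2, K3\<close>.  Putting \<open>x = y = z = w\<^sub>l\<close> at \<open>p l\<close> gives the
  right cubic term.  It also produces quadratic terms such as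
  \<open>w\<^sub>l \<otimes> w\<^sub>l \<otimes> e\<^sub>c\<close> with \<open>c\<close> the third component of \<open>p l\<close>; this one is cancelled by putting
  \<open>x = w\<^sub>l\<close>, \<open>y = - w\<^sub>l\<close>, \<open>z = 0\<close> at \<open>q3 l\<close>, which has the same third component, and the other
  two are cancelled at \<open>q1 l\<close> and \<open>q2 l\<close> in the same way.  The linear terms are cancelled by the
  layers with a zero index: each \<open>x\<close> placed at \<open>(i1, i2, i3)\<close> is subtracted at \<open>(0, i2, i3)\<close>, and
  correspondingly for \<open>y\<close> and \<open>z\<close>.  At those additional places at most one of \<open>x, y, z\<close> is nonzero,
  so they contribute nothing of order two or three.
\<close>

section \<open>Matrices near the identity\<close>

text \<open>Gaussian elimination, one equation at a time.\<close>

lemma homogeneous_system_nontrivial: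
  fixes Q :: "'i \<Rightarrow> 'l \<Rightarrow> 'f::field"
  assumes "finite I" "finite L" "card I < card L"
  shows "\<exists>c. (\<exists>l\<in>L. c l \<noteq> 0) \<and> (\<forall>i\<in>I. (\<Sum>l\<in>L. Q i l * c l) = 0)"
  using assms
proof (induction I arbitrary: L Q rule: finite_induct)
  case empty
  then have "L \<noteq> {}" by auto
  then show ?case by (intro exI[of _ "\<lambda>_. 1"]) auto
next
  case (insert i0 I)
  show ?case
  proof (cases "\<forall>l\<in>L. Q i0 l = 0")
    case True
    from insert.IH[of L Q] insert.hyps insert.prems
    obtain c where "\<exists>l\<in>L. c l \<noteq> 0" "\<forall>i\<in>I. (\<Sum>l\<in>L. Q i l * c l) = 0" by auto
    with True show ?thesis by (intro exI[of _ c]) auto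
  next
    case False
    then obtain l0 where l0: "l0 \<in> L" "Q i0 l0 \<noteq> 0" by blast
    (* Eliminate the unknown l0 from all equations by means of equation i0. *)
    define L' where "L' = L - {l0}"
    define Q' where "Q' i l = Q i l - Q i l0 / Q i0 l0 * Q i0 l" for i l
    have "finite L'" "card I < card L'"
      using insert.hyps insert.prems l0 by (auto simp: L'_def)
    from insert.IH[OF this, of Q'] obtain c where
      c: "\<exists>l\<in>L'. c l \<noteq> 0" "\<And>i. i \<in> I \<Longrightarrow> (\<Sum>l\<in>L'. Q' i l * c l) = 0" by blast
    define c' where "c' = c(l0 := - (\<Sum>l\<in>L'. Q i0 l * c l) / Q i0 l0)"
    have split: "(\<Sum>l\<in>L. Q i l * c' l) = Q i l0 * c' l0 + (\<Sum>l\<in>L'. Q i l * c l)" for i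
    proof -
      have "(\<Sum>l\<in>L'. Q i l * c' l) = (\<Sum>l\<in>L'. Q i l * c l)"
        by (rule sum.cong) (auto simp: L'_def c'_def)
      then show ?thesis
        using insert.prems(1) l0(1) by (simp add: L'_def sum.remove)
    qed
    have "(\<Sum>l\<in>L. Q i0 l * c' l) = 0"
      unfolding split using l0(2) by (simp add: c'_def)
    moreover have "(\<Sum>l\<in>L. Q i l * c' l) = 0" if "i \<in> I" for i
    proof -
      have "(\<Sum>l\<in>L'. Q' i l * c l)
          = (\<Sum>l\<in>L'. Q i l * c l) - Q i l0 / Q i0 l0 * (\<Sum>l\<in>L'. Q i0 l * c l)"
        by (simp add: Q'_def algebra_simps sum_subtractf sum_distrib_left)
      then show ?thesis
        using c(2)[OF that] unfolding split by (simp add: c'_def)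
    qed
    moreover have "\<exists>l\<in>L. c' l \<noteq> 0"
      using c(1) by (auto simp: c'_def L'_def)
    ultimately show ?thesis by blast
  qed
qed

text \<open>
  With fewer than \<open>card K\<close> summands, \<open>G\<close> would have a nonzero kernel vector.  But in a row where
  that vector is largest in modulus, the diagonal entry dominates the rest of the row.
\<close>

lemma near_identity_rank_ge:
  fixes G :: "'k \<Rightarrow> 'k \<Rightarrow> complex"
  assumes "finite K"
    and fac: "\<And>k l. k \<in> K \<Longrightarrow> l \<in> K \<Longrightarrow> G k l = (\<Sum>i<r. P k i * Q i l)"
    and near: "\<And>k l. k \<in> K \<Longrightarrow> l \<in> K \<Longrightarrow> norm (G k l - of_bool (k = l)) < 1 / card K"
  shows "card K \<le> r"
proof (rule ccontr)
  assume "\<not> card K \<le> r"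
  then have "card {..<r} < card K" by simp
  from homogeneous_system_nontrivial[OF _ assms(1) this, of Q] obtain c where
    c: "\<exists>l\<in>K. c l \<noteq> 0" "\<And>i. i < r \<Longrightarrow> (\<Sum>l\<in>K. Q i l * c l) = 0" by auto
  have "K \<noteq> {}" using c(1) by auto
  obtain k where k: "k \<in> K" "\<And>l. l \<in> K \<Longrightarrow> norm (c l) \<le> norm (c k)"
  proof -
    have "Max ((norm \<circ> c) ` K) \<in> (norm \<circ> c) ` K"
      using assms(1) \<open>K \<noteq> {}\<close> by (intro Max_in) auto
    then obtain k where "k \<in> K" "norm (c k) = Max ((norm \<circ> c) ` K)" by auto
    with assms(1) show ?thesis by (intro that[of k]) auto
  qed
  have "norm (c k) > 0" using c(1) k(2) by fastforce
  have "(\<Sum>l\<in>K. G k l * c l) = (\<Sum>l\<in>K. \<Sum>i<r. P k i * (Q i l * c l))"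
    by (rule sum.cong) (auto simp: fac k(1) sum_distrib_right mult.assoc)
  also have "\<dots> = (\<Sum>i<r. P k i * (\<Sum>l\<in>K. Q i l * c l))"
    by (subst sum.swap) (simp add: sum_distrib_left)
  also have "\<dots> = 0" using c(2) by simp
  finally have "(\<Sum>l\<in>K. G k l * c l) = 0" .
  moreover have "(\<Sum>l\<in>K. of_bool (k = l) * c l) = c k"
    using assms(1) k(1) by (simp add: of_bool_def if_distrib[of "\<lambda>x. x * _"] cong: if_cong)
  ultimately have "(\<Sum>l\<in>K. (G k l - of_bool (k = l)) * c l) = - c k"
    by (simp add: left_diff_distrib sum_subtractf)
  then have "norm (c k) = norm (\<Sum>l\<in>K. (G k l - of_bool (k = l)) * c l)" by simp
  also have "\<dots> \<le> (\<Sum>l\<in>K. norm ((G k l - of_bool (k = l)) * c l))" by (rule norm_sum)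
  also have "\<dots> < (\<Sum>l\<in>K. 1 / card K * norm (c k))"
  proof (rule sum_strict_mono[OF assms(1) \<open>K \<noteq> {}\<close>])
    fix l assume l: "l \<in> K"
    have "norm ((G k l - of_bool (k = l)) * c l) \<le> norm (G k l - of_bool (k = l)) * norm (c k)"
      unfolding norm_mult by (rule mult_left_mono[OF k(2)[OF l]]) simp
    also have "\<dots> < 1 / card K * norm (c k)"
      using near[OF k(1) l] \<open>norm (c k) > 0\<close> by (rule mult_strict_right_mono)
    finally show "norm ((G k l - of_bool (k = l)) * c l) < 1 / card K * norm (c k)" .
  qed
  also have "\<dots> = norm (c k)" using assms(1) \<open>K \<noteq> {}\<close> by simp
  finally show False by simp
qed

section \<open>Lower bounds for border rank from identity blocks\<close>

text \<open>The predicate minimised in the definition of tensor rank.\<close>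

definition sum_of_pures ::
  "'a set \<Rightarrow> 'b set \<Rightarrow> 'c set \<Rightarrow> 'd set \<Rightarrow> nat \<Rightarrow> ('a \<times> 'b \<times> 'c \<times> 'd \<Rightarrow> complex) \<Rightarrow> bool" where
  "sum_of_pures A B C D r T \<longleftrightarrow> (\<exists>u v w z.
     (\<forall>i<r. u i \<in> coord_space A \<and> v i \<in> coord_space B \<and>
            w i \<in> coord_space C \<and> z i \<in> coord_space D) \<and>
     T = (\<lambda>x. \<Sum>i<r. pure_tensor (u i) (v i) (w i) (z i) x))"

lemma tensor_rank_alt: "tensor_rank A B C D T = (LEAST r. sum_of_pures A B C D r T)"
  by (simp add: tensor_rank_def sum_of_pures_def)

lemma sum_of_puresI:
  assumes "finite I"
    and "\<And>i. i \<in> I \<Longrightarrow> u i \<in> coord_space A" "\<And>i. i \<in> I \<Longrightarrow> v i \<in> coord_space B"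
    and "\<And>i. i \<in> I \<Longrightarrow> w i \<in> coord_space C" "\<And>i. i \<in> I \<Longrightarrow> z i \<in> coord_space D"
    and T: "\<And>x. T x = (\<Sum>i\<in>I. pure_tensor (u i) (v i) (w i) (z i) x)"
  shows "sum_of_pures A B C D (card I) T"
proof -
  obtain h where h: "bij_betw h {..<card I} I"
    using ex_bij_betw_nat_finite[OF assms(1)] by (auto simp: atLeast0LessThan)
  then have "h i \<in> I" if "i < card I" for i using that by (auto simp: bij_betw_def)
  moreover have "T = (\<lambda>x. \<Sum>i<card I. pure_tensor (u (h i)) (v (h i)) (w (h i)) (z (h i)) x)"
    unfolding T fun_eq_iff by (intro allI sum.reindex_bij_betw[OF h, symmetric])
  ultimately show ?thesis unfolding sum_of_pures_def
    by (intro exI[of _ "\<lambda>i. u (h i)"] exI[of _ "\<lambda>i. v (h i)"]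
          exI[of _ "\<lambda>i. w (h i)"] exI[of _ "\<lambda>i. z (h i)"]) (auto simp: assms)
qed

lemma sum_of_pures_coord_space:
  assumes "sum_of_pures A B C D r T"
  shows "T \<in> coord_space (A \<times> B \<times> C \<times> D)"
proof -
  obtain u v w z where
    mem: "\<And>i. i < r \<Longrightarrow> u i \<in> coord_space A \<and> v i \<in> coord_space B \<and>
            w i \<in> coord_space C \<and> z i \<in> coord_space D" and
    T: "T = (\<lambda>x. \<Sum>i<r. pure_tensor (u i) (v i) (w i) (z i) x)"
    using assms unfolding sum_of_pures_def by blast
  have "(\<Sum>i<r. pure_tensor (u i) (v i) (w i) (z i) x) = 0" if "x \<notin> A \<times> B \<times> C \<times> D" for x
    using mem that by (intro sum.neutral ballI)
      (cases x, fastforce simp: coord_space_def pure_tensor_def)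
  then show ?thesis by (simp add: coord_space_def T)
qed

text \<open>
  Expanding a tensor in the standard basis shows that some decomposition exists, so the minimum
  defining the rank is attained.
\<close>

lemma tensor_rank_decomposition:
  assumes "finite A" "finite B" "finite C" "finite D" "T \<in> coord_space (A \<times> B \<times> C \<times> D)"
  shows "sum_of_pures A B C D (tensor_rank A B C D T) T"
proof -
  let ?X = "A \<times> B \<times> C \<times> D"
  have fin: "finite ?X" using assms by simp
  have "sum_of_pures A B C D (card ?X) T"
  proof (rule sum_of_puresI[OF fin])
    fix x :: "'a \<times> 'b \<times> 'c \<times> 'd"
    obtain a b c d where x: "x = (a, b, c, d)" by (cases x)
    have "(\<Sum>i\<in>?X. pure_tensor (\<lambda>a. T i * basis_vec (fst i) a) (basis_vec (fst (snd i)))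
             (basis_vec (fst (snd (snd i)))) (basis_vec (snd (snd (snd i)))) x)
        = (\<Sum>i\<in>?X. if x = i then T i else 0)"
      by (intro sum.cong) (auto simp: pure_tensor_def basis_vec_def x)
    also have "\<dots> = T x"
      using assms(5) fin by (cases "x \<in> ?X") (auto simp: coord_space_def x)
    finally show "T x = (\<Sum>i\<in>?X. pure_tensor (\<lambda>a. T i * basis_vec (fst i) a)
        (basis_vec (fst (snd i))) (basis_vec (fst (snd (snd i)))) (basis_vec (snd (snd (snd i)))) x)"
      by simp
  qed (auto simp: coord_space_def basis_vec_def)
  then show ?thesis unfolding tensor_rank_alt by (rule LeastI)
qed

text \<open>
  The array \<open>\<sigma>\<close> selects a submatrix of a flattening: pure tensors have rank at most one there.
  Which modes index the rows and which the columns is left open, as different tensors call for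
  different flattenings.
\<close>

definition separates_modes :: "('k \<Rightarrow> 'k \<Rightarrow> 'a \<times> 'b \<times> 'c \<times> 'd) \<Rightarrow> bool" where
  "separates_modes \<sigma> \<longleftrightarrow>
     (\<forall>u v w z. \<exists>P Q. \<forall>k l. pure_tensor u v w z (\<sigma> k l) = P k * Q l)"

lemma separates_modes_last: "separates_modes (\<lambda>k l. (f k, g k, h k, j l))"
  unfolding separates_modes_def
proof (intro allI)
  fix u v w z
  show "\<exists>P Q. \<forall>k l. pure_tensor u v w z (f k, g k, h k, j l) = P k * Q l"
    by (intro exI[of _ "\<lambda>k. u (f k) * v (g k) * w (h k)"] exI[of _ "\<lambda>l. z (j l)"])
      (simp add: pure_tensor_def)
qed

lemma separates_modes_first: "separates_modes (\<lambda>k l. (f k, g l, h l, j l))"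
  unfolding separates_modes_def
proof (intro allI)
  fix u v w z
  show "\<exists>P Q. \<forall>k l. pure_tensor u v w z (f k, g l, h l, j l) = P k * Q l"
    by (intro exI[of _ "\<lambda>k. u (f k)"] exI[of _ "\<lambda>l. v (g l) * w (h l) * z (j l)"])
      (simp add: pure_tensor_def)
qed

lemma sum_of_pures_ge_near_identity:
  assumes "finite K" "separates_modes \<sigma>" "sum_of_pures A B C D r T"
    and near: "\<And>k l. k \<in> K \<Longrightarrow> l \<in> K \<Longrightarrow> norm (T (\<sigma> k l) - of_bool (k = l)) < 1 / card K"
  shows "card K \<le> r"
proof -
  obtain u v w z where T: "T = (\<lambda>x. \<Sum>i<r. pure_tensor (u i) (v i) (w i) (z i) x)"
    using assms(3) unfolding sum_of_pures_def by blast
  have "\<forall>i. \<exists>P Q. \<forall>k l. pure_tensor (u i) (v i) (w i) (z i) (\<sigma> k l) = P k * Q l"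
    using assms(2) by (simp add: separates_modes_def)
  then obtain P Q where "\<And>i k l. pure_tensor (u i) (v i) (w i) (z i) (\<sigma> k l) = P i k * Q i l"
    by metis
  then show ?thesis
    using near by (intro near_identity_rank_ge[OF assms(1),
        where G = "\<lambda>k l. T (\<sigma> k l)" and P = "\<lambda>k i. P i k" and Q = Q])
      (auto simp: T)
qed

text \<open>
  Border rank asks for tensors of rank exactly \<open>r\<close> at every nonzero parameter.  Near \<open>0\<close> the
  identity block of the limit forces rank at least \<open>card K\<close>, so the given decompositions are
  optimal there.  Away from \<open>0\<close> the family may be replaced by any one of its good members without
  changing the limit.  Hence decompositions into \<open>card K\<close> pure tensors suffice as a hypothesis.
\<close>

lemma border_rank_eqI:
  fixes F :: "complex \<Rightarrow> 'a \<times> 'b \<times> 'c \<times> 'd \<Rightarrow> complex"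
  assumes fin: "finite A" "finite B" "finite C" "finite D" "finite K"
    and sep: "separates_modes \<sigma>"
    and ident: "\<And>k l. k \<in> K \<Longrightarrow> l \<in> K \<Longrightarrow> T (\<sigma> k l) = of_bool (k = l)"
    and dec: "\<And>\<epsilon>. \<epsilon> \<noteq> 0 \<Longrightarrow> sum_of_pures A B C D (card K) (F \<epsilon>)"
    and lim: "\<And>x. ((\<lambda>\<epsilon>. F \<epsilon> x) \<longlongrightarrow> T x) (at 0)"
  shows "border_rank A B C D T = card K"
proof -
  define near where "near S \<longleftrightarrow> (\<forall>k\<in>K. \<forall>l\<in>K. norm (S (\<sigma> k l) - of_bool (k = l)) < 1 / card K)"
    for S :: "'a \<times> 'b \<times> 'c \<times> 'd \<Rightarrow> complex"
  have ge: "card K \<le> r" if "near S" "sum_of_pures A B C D r S" for S r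
    using sum_of_pures_ge_near_identity[OF fin(5) sep that(2)] that(1) by (simp add: near_def)
  have eventually_near: "eventually (\<lambda>\<epsilon>. near (G \<epsilon>) \<and> \<epsilon> \<noteq> 0) (at 0)"
    if G: "\<And>x. ((\<lambda>\<epsilon>. G \<epsilon> x) \<longlongrightarrow> T x) (at 0)"
    for G :: "complex \<Rightarrow> 'a \<times> 'b \<times> 'c \<times> 'd \<Rightarrow> complex"
  proof -
    have "eventually (\<lambda>\<epsilon>. norm (G \<epsilon> (\<sigma> k l) - of_bool (k = l)) < 1 / card K) (at 0)"
      if "k \<in> K" "l \<in> K" for k l
    proof -
      have "0 < 1 / real (card K)" using that fin(5) by (auto simp: card_gt_0_iff)
      from tendstoD[OF G[of "\<sigma> k l"] this] show ?thesis
        using ident[OF that] by (simp add: dist_norm)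
    qed
    then show ?thesis
      unfolding near_def using fin(5)
      by (intro eventually_conj eventually_ball_finite ballI eventually_neq_at_within) auto
  qed
  have rank: "tensor_rank A B C D S = card K"
    if "near S" "sum_of_pures A B C D (card K) S" for S
    unfolding tensor_rank_alt using that ge by (intro Least_equality) auto
  obtain \<epsilon>0 where \<epsilon>0: "near (F \<epsilon>0)" "\<epsilon>0 \<noteq> 0"
    using eventually_happens'[OF _ eventually_near[of F, OF lim]] by auto
  (* Parameters at which F is not near the identity block do not affect the limit. *)
  define F' where "F' \<epsilon> = (if near (F \<epsilon>) then F \<epsilon> else F \<epsilon>0)" for \<epsilon>
  show ?thesis
    unfolding border_rank_def
  proof (rule Least_equality)
    have "F' \<epsilon> \<in> coord_space (A \<times> B \<times> C \<times> D) \<and> tensor_rank A B C D (F' \<epsilon>) = card K"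
      if "\<epsilon> \<noteq> 0" for \<epsilon>
      using sum_of_pures_coord_space[OF dec] rank[OF _ dec] that \<epsilon>0 by (auto simp: F'_def)
    moreover have "((\<lambda>\<epsilon>. F' \<epsilon> x) \<longlongrightarrow> T x) (at 0)" for x
    proof (rule Lim_transform_eventually[OF lim])
      show "eventually (\<lambda>\<epsilon>. F \<epsilon> x = F' \<epsilon> x) (at 0)"
        using eventually_near[of F, OF lim] by eventually_elim (simp add: F'_def)
    qed
    ultimately show "\<exists>F :: complex \<Rightarrow> _. (\<forall>\<epsilon>. \<epsilon> \<noteq> 0 \<longrightarrow> F \<epsilon> \<in> coord_space (A \<times> B \<times> C \<times> D)
          \<and> tensor_rank A B C D (F \<epsilon>) = card K) \<and> (\<forall>x. ((\<lambda>\<epsilon>. F \<epsilon> x) \<longlongrightarrow> T x) (at 0))"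
      by blast
  next
    fix r
    assume "\<exists>G :: complex \<Rightarrow> 'a \<times> 'b \<times> 'c \<times> 'd \<Rightarrow> complex.
      (\<forall>\<epsilon>. \<epsilon> \<noteq> 0 \<longrightarrow> G \<epsilon> \<in> coord_space (A \<times> B \<times> C \<times> D) \<and> tensor_rank A B C D (G \<epsilon>) = r)
          \<and> (\<forall>x. ((\<lambda>\<epsilon>. G \<epsilon> x) \<longlongrightarrow> T x) (at 0))"
    then obtain G :: "complex \<Rightarrow> 'a \<times> 'b \<times> 'c \<times> 'd \<Rightarrow> complex" where
      G: "\<And>\<epsilon>. \<epsilon> \<noteq> 0 \<Longrightarrow> G \<epsilon> \<in> coord_space (A \<times> B \<times> C \<times> D) \<and> tensor_rank A B C D (G \<epsilon>) = r"
        "\<And>x. ((\<lambda>\<epsilon>. G \<epsilon> x) \<longlongrightarrow> T x) (at 0)" by blast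
    obtain \<epsilon> where \<epsilon>: "near (G \<epsilon>)" "\<epsilon> \<noteq> 0"
      using eventually_happens'[OF _ eventually_near[of G, OF G(2)]] by auto
    with tensor_rank_decomposition[OF fin(1-4), of "G \<epsilon>"] G(1)
    have "sum_of_pures A B C D r (G \<epsilon>)" by auto
    with \<epsilon>(1) show "card K \<le> r" by (rule ge)
  qed
qed

section \<open>Perturbations supported on matched points\<close>

lemma sum_of_bool_eq_mult:
  fixes f :: "'i \<Rightarrow> complex"
  assumes "finite I" "k \<in> I"
  shows "(\<Sum>i\<in>I. of_bool (i = k) * f i) = f k"
proof -
  have "(\<Sum>i\<in>I. of_bool (i = k) * f i) = (\<Sum>i\<in>I. if i = k then f i else 0)"
    by (rule sum.cong) auto
  with assms show ?thesis by simp
qed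

lemma sum_product_box:
  fixes f g h :: "nat \<Rightarrow> complex"
  shows "(\<Sum>i\<in>A \<times> B \<times> C. f (fst i) * (g (fst (snd i)) * h (snd (snd i))))
    = sum f A * (sum g B * sum h C)"
proof -
  have "sum g B * sum h C = (\<Sum>j\<in>B \<times> C. g (fst j) * h (snd j))"
    by (simp add: sum_product sum.cartesian_product split_def)
  then show ?thesis
    by (simp add: sum_product sum.cartesian_product split_def)
qed

lemma basis_vec_sum_type [simp]:
  "basis_vec (Inl i) (Inl a) = basis_vec i a" "basis_vec (Inl i) (Inr b) = 0"
  "basis_vec (Inr j) (Inl a) = 0" "basis_vec (Inr j) (Inr b) = basis_vec j b"
  by (auto simp: basis_vec_def)

lemma basis_vec_coord_space [simp]: "basis_vec i \<in> coord_space A \<longleftrightarrow> i \<in> A"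
  by (auto simp: basis_vec_def coord_space_def)

text \<open>
  The sets \<open>J, K1, K2, K3\<close> enumerated compatibly with the bijections: \<open>p\<close> runs through \<open>J\<close>, and
  \<open>q1 l, q2 l, q3 l\<close> are the partners of \<open>p l\<close>.
\<close>

locale disjoint_matched_points =
  fixes n1 n2 n3 M :: nat
    and p q1 q2 q3 :: "nat \<Rightarrow> nat \<times> nat \<times> nat"
  assumes box: "l \<in> {1..M} \<Longrightarrow> {p l, q1 l, q2 l, q3 l} \<subseteq> {1..n1} \<times> {1..n2} \<times> {1..n3}"
    and inj: "inj_on p {1..M}" "inj_on q1 {1..M}" "inj_on q2 {1..M}" "inj_on q3 {1..M}"
    and disj: "l \<in> {1..M} \<Longrightarrow> l' \<in> {1..M} \<Longrightarrow> p l \<noteq> q1 l' \<and> p l \<noteq> q2 l' \<and> p l \<noteq> q3 l' \<and>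
      q1 l \<noteq> q2 l' \<and> q1 l \<noteq> q3 l' \<and> q2 l \<noteq> q3 l'"
    and agree1: "l \<in> {1..M} \<Longrightarrow> fst (q1 l) = fst (p l)"
    and agree2: "l \<in> {1..M} \<Longrightarrow> fst (snd (q2 l)) = fst (snd (p l))"
    and agree3: "l \<in> {1..M} \<Longrightarrow> snd (snd (q3 l)) = snd (snd (p l))"
begin

definition "I = {0..n1} \<times> {0..n2} \<times> {0..n3}"

abbreviation (input) "erase1 i \<equiv> (0::nat, snd i)"
abbreviation (input) "erase2 i \<equiv> (fst i, 0::nat, snd (snd i))"
abbreviation (input) "erase3 i \<equiv> (fst i, fst (snd i), 0::nat)"

text \<open>
  A unit weight at \<open>k\<close>, compensated at \<open>\<pi> k\<close>, so that it is invisible to functions that do not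
  distinguish \<open>k\<close> from \<open>\<pi> k\<close>.
\<close>

definition balanced :: "('i \<Rightarrow> 'i) \<Rightarrow> 'i \<Rightarrow> 'i \<Rightarrow> complex" where
  "balanced \<pi> k i = of_bool (i = k) - of_bool (i = \<pi> k)"

text \<open>
  The coefficients of \<open>w\<^sub>l\<close> in \<open>x\<^sub>i, y\<^sub>i, z\<^sub>i\<close>.  All three are \<open>1\<close> at \<open>p l\<close>.  At \<open>q1 l\<close> the second
  and third are \<open>1\<close> and \<open>-1\<close>, at \<open>q2 l\<close> the first and third, at \<open>q3 l\<close> the first and second; the
  remaining one is \<open>0\<close>.  The compensating weights lie in the layers with a zero index.
\<close>

definition "coeff1 i l =
  balanced (\<lambda>i. erase1 i) (p l) i
  + balanced (\<lambda>i. erase1 i) (q2 l) i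
  + balanced (\<lambda>i. erase1 i) (q3 l) i"
definition "coeff2 i l =
  balanced (\<lambda>i. erase2 i) (p l) i
  + balanced (\<lambda>i. erase2 i) (q1 l) i
  - balanced (\<lambda>i. erase2 i) (q3 l) i"
definition "coeff3 i l =
  balanced (\<lambda>i. erase3 i) (p l) i
  - balanced (\<lambda>i. erase3 i) (q1 l) i
  - balanced (\<lambda>i. erase3 i) (q2 l) i"

lemma finite_I [simp]: "finite I" by (simp add: I_def)

lemma card_I: "card I = (n1 + 1) * (n2 + 1) * (n3 + 1)"
  by (simp add: I_def card_cartesian_product algebra_simps)

lemma points_pos:
  assumes "l \<in> {1..M}" "k \<in> {p l, q1 l, q2 l, q3 l}"
  shows "fst k \<in> {1..n1} \<and> fst (snd k) \<in> {1..n2} \<and> snd (snd k) \<in> {1..n3}"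
  using box[OF assms(1)] assms(2) by auto

lemma points_in_I:
  assumes "l \<in> {1..M}" "k \<in> {p l, q1 l, q2 l, q3 l}"
  shows "k \<in> I" "erase1 k \<in> I" "erase2 k \<in> I" "erase3 k \<in> I"
  using points_pos[OF assms] by (cases k; auto simp: I_def)+

lemma sum_balanced:
  assumes "k \<in> I" "\<pi> k \<in> I" "f (\<pi> k) = f k"
  shows "(\<Sum>i\<in>I. balanced \<pi> k i * f i) = 0"
  using assms by (simp add: balanced_def left_diff_distrib sum_subtractf sum_of_bool_eq_mult)

text \<open>
  A linear term in one factor carries basis vectors that only depend on the other two components of
  the index, and erasing a component leaves the other two alone.
\<close>

lemma first_order_term:
  assumes "l \<in> {1..M}"
  shows "(\<And>i. f (erase1 i) = f i) \<Longrightarrow> (\<Sum>i\<in>I. coeff1 i l * f i) = 0"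
    and "(\<And>i. f (erase2 i) = f i) \<Longrightarrow> (\<Sum>i\<in>I. coeff2 i l * f i) = 0"
    and "(\<And>i. f (erase3 i) = f i) \<Longrightarrow> (\<Sum>i\<in>I. coeff3 i l * f i) = 0"
  unfolding coeff1_def coeff2_def coeff3_def distrib_right left_diff_distrib sum.distrib sum_subtractf
  using points_in_I[OF assms] by (simp_all add: sum_balanced)

lemma coeff1_values:
  assumes "l \<in> {1..M}"
  shows "fst i \<noteq> 0 \<Longrightarrow> coeff1 i l = of_bool (i = p l) + of_bool (i = q2 l) + of_bool (i = q3 l)"
    and "fst (snd i) = 0 \<or> snd (snd i) = 0 \<Longrightarrow> coeff1 i l = 0"
proof -
  show "coeff1 i l = 0" if "fst (snd i) = 0 \<or> snd (snd i) = 0"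
  proof -
    have "i \<noteq> k \<and> i \<noteq> erase1 k" if "k \<in> {p l, q1 l, q2 l, q3 l}" for k
      using points_pos[OF assms that] \<open>fst (snd i) = 0 \<or> snd (snd i) = 0\<close> by auto
    then show ?thesis by (simp add: coeff1_def balanced_def)
  qed
qed (cases i; simp add: coeff1_def balanced_def)

lemma coeff2_values:
  assumes "l \<in> {1..M}"
  shows "fst (snd i) \<noteq> 0 \<Longrightarrow> coeff2 i l = of_bool (i = p l) + of_bool (i = q1 l) - of_bool (i = q3 l)"
    and "fst i = 0 \<or> snd (snd i) = 0 \<Longrightarrow> coeff2 i l = 0"
proof -
  show "coeff2 i l = 0" if "fst i = 0 \<or> snd (snd i) = 0"
  proof -
    have "i \<noteq> k \<and> i \<noteq> erase2 k" if "k \<in> {p l, q1 l, q2 l, q3 l}" for k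
      using points_pos[OF assms that] \<open>fst i = 0 \<or> snd (snd i) = 0\<close> by auto
    then show ?thesis by (simp add: coeff2_def balanced_def)
  qed
qed (cases i; simp add: coeff2_def balanced_def)

lemma coeff3_values:
  assumes "l \<in> {1..M}"
  shows "snd (snd i) \<noteq> 0 \<Longrightarrow> coeff3 i l = of_bool (i = p l) - of_bool (i = q1 l) - of_bool (i = q2 l)"
    and "fst i = 0 \<or> fst (snd i) = 0 \<Longrightarrow> coeff3 i l = 0"
proof -
  show "coeff3 i l = 0" if "fst i = 0 \<or> fst (snd i) = 0"
  proof -
    have "i \<noteq> k \<and> i \<noteq> erase3 k" if "k \<in> {p l, q1 l, q2 l, q3 l}" for k
      using points_pos[OF assms that] \<open>fst i = 0 \<or> fst (snd i) = 0\<close> by auto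
    then show ?thesis by (simp add: coeff3_def balanced_def)
  qed
qed (cases i; simp add: coeff3_def balanced_def)

text \<open>
  Two different coefficients are both nonzero only at points without a zero component, because
  each compensating weight has exactly one zero component and the other coefficients vanish there.
  Among the points without a zero component, disjointness and injectivity keep different labels
  apart.
\<close>

lemma coeff_products:
  assumes l: "l \<in> {1..M}" and l': "l' \<in> {1..M}"
  shows "coeff1 i l * coeff2 i l' = of_bool (l = l') * (of_bool (i = p l) - of_bool (i = q3 l))" (is ?xy)
    and "coeff1 i l * coeff3 i l' = of_bool (l = l') * (of_bool (i = p l) - of_bool (i = q2 l))" (is ?xz)
    and "coeff2 i l * coeff3 i l' = of_bool (l = l') * (of_bool (i = p l) - of_bool (i = q1 l))" (is ?yz)
proof -
  have "?xy \<and> ?xz \<and> ?yz"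
  proof (cases "fst i = 0 \<or> fst (snd i) = 0 \<or> snd (snd i) = 0")
    case True
    then have "i \<notin> {p l, q1 l, q2 l, q3 l}" using points_pos[OF l, of i] by auto
    with True coeff1_values(2)[OF l, of i] coeff2_values(2)[OF l, of i]
      coeff2_values(2)[OF l', of i] coeff3_values(2)[OF l', of i]
    show ?thesis by auto
  next
    case False
    with coeff1_values(1)[OF l, of i] coeff2_values(1)[OF l, of i]
      coeff2_values(1)[OF l', of i] coeff3_values(1)[OF l', of i]
    have "coeff1 i l = of_bool (i = p l) + of_bool (i = q2 l) + of_bool (i = q3 l)"
      "coeff2 i l = of_bool (i = p l) + of_bool (i = q1 l) - of_bool (i = q3 l)"
      "coeff2 i l' = of_bool (i = p l') + of_bool (i = q1 l') - of_bool (i = q3 l')"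
      "coeff3 i l' = of_bool (i = p l') - of_bool (i = q1 l') - of_bool (i = q2 l')"
      by auto
    then show ?thesis
      using inj[THEN inj_on_eq_iff, OF l l'] disj[OF l l'] disj[OF l' l] disj[OF l l]
      by (cases "i = p l"; cases "i = q1 l"; cases "i = q2 l"; cases "i = q3 l") auto
  qed
  then show ?xy ?xz ?yz by auto
qed

text \<open>
  The weight \<open>1\<close> at \<open>p l\<close> and the weight \<open>-1\<close> at the partner cancel, since the basis vector of the
  remaining factor only sees the component on which the two points agree.
\<close>

lemma second_order_term:
  assumes "l \<in> {1..M}" "l' \<in> {1..M}"
  shows "(\<Sum>i\<in>I. coeff1 i l * coeff2 i l' * f (snd (snd i))) = 0"
    and "(\<Sum>i\<in>I. coeff1 i l * coeff3 i l' * f' (fst (snd i))) = 0"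
    and "(\<Sum>i\<in>I. coeff2 i l * coeff3 i l' * f'' (fst i)) = 0"
  unfolding coeff_products[OF assms] mult.assoc left_diff_distrib sum_distrib_left[symmetric] sum_subtractf
  using points_in_I[OF assms(1)] agree1[OF assms(1)] agree2[OF assms(1)] agree3[OF assms(1)]
  by (simp_all add: sum_of_bool_eq_mult)

text \<open>
  Of the two points where the first two coefficients meet, the third one vanishes at \<open>q3 l\<close>.
\<close>

lemma third_order_term:
  assumes "l \<in> {1..M}" "l' \<in> {1..M}" "l'' \<in> {1..M}"
  shows "(\<Sum>i\<in>I. coeff1 i l * coeff2 i l' * coeff3 i l'') = of_bool (l = l' \<and> l = l'')"
proof -
  have "coeff1 i l * coeff2 i l' * coeff3 i l'' = of_bool (i = p l) * of_bool (l = l' \<and> l = l'')"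
    if "i \<in> I" for i
  proof (cases "i = p l \<or> i = q3 l")
    case True
    then have "snd (snd i) \<noteq> 0" using points_pos[OF assms(1), of i] by auto
    with True show ?thesis
      using coeff_products(1)[OF assms(1,2), of i] coeff3_values(1)[OF assms(3), of i]
        disj[OF assms(1,3)] disj[OF assms(3,1)] disj[OF assms(1,1)]
        inj[THEN inj_on_eq_iff, OF assms(1,3)] by auto
  next
    case False
    then show ?thesis using coeff_products(1)[OF assms(1,2), of i] by auto
  qed
  then have "(\<Sum>i\<in>I. coeff1 i l * coeff2 i l' * coeff3 i l'')
      = (\<Sum>i\<in>I. of_bool (i = p l) * of_bool (l = l' \<and> l = l''))" by (rule sum.cong[OF refl])
  then show ?thesis using points_in_I[OF assms(1)] by (simp add: sum_of_bool_eq_mult)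
qed

section \<open>The degeneration\<close>

text \<open>
  The perturbation vectors \<open>\<Sum>l. g i l w\<^sub>l\<close>, placed in the second summand of the direct sum.
\<close>

definition on_right ::
  "(nat \<times> nat \<times> nat \<Rightarrow> nat \<Rightarrow> complex) \<Rightarrow> nat \<times> nat \<times> nat \<Rightarrow> nat + nat \<Rightarrow> complex"
  where "on_right g i s = (case s of Inl _ \<Rightarrow> 0 | Inr l \<Rightarrow> if l \<in> {1..M} then g i l else 0)"

lemma on_right_cases:
  obtains "\<And>g i. on_right g i s = 0"
  | l where "l \<in> {1..M}" "s = Inr l" "\<And>g i. on_right g i s = g i l"
proof (cases "\<exists>l\<in>{1..M}. s = Inr l")
  case True
  then obtain l where "l \<in> {1..M}" "s = Inr l" by blast
  then show thesis by (intro that(2)) (auto simp: on_right_def)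
next
  case False
  then show thesis by (intro that(1)) (auto simp: on_right_def split: sum.split)
qed

text \<open>
  The constant term factors because the index set is a full box.  The linear and quadratic terms
  are instances of \<open>first_order_term\<close> and \<open>second_order_term\<close>.
\<close>

lemma expansion:
  "(\<Sum>i\<in>I. (basis_vec (Inl (fst i)) a + \<epsilon> * on_right coeff1 i a)
        * (basis_vec (Inl (fst (snd i))) b + \<epsilon> * on_right coeff2 i b)
        * (basis_vec (Inl (snd (snd i))) c + \<epsilon> * on_right coeff3 i c))
   = (\<Sum>t=0..n1. basis_vec (Inl t) a) * (\<Sum>t=0..n2. basis_vec (Inl t) b)
        * (\<Sum>t=0..n3. basis_vec (Inl t) c)
     + \<epsilon> ^ 3 * (\<Sum>l=1..M. basis_vec (Inr l) a * basis_vec (Inr l) b * basis_vec (Inr l) c)"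
proof -
  define e1 e2 e3 where "e1 i = basis_vec (Inl (fst i)) a" and "e2 i = basis_vec (Inl (fst (snd i))) b"
    and "e3 i = basis_vec (Inl (snd (snd i))) c" for i :: "nat \<times> nat \<times> nat"
  define X Y Z where "X i = on_right coeff1 i a"
    and "Y i = on_right coeff2 i b" and "Z i = on_right coeff3 i c" for i
  note defs = e1_def e2_def e3_def X_def Y_def Z_def
  have S0: "(\<Sum>i\<in>I. e1 i * e2 i * e3 i)
     = (\<Sum>t=0..n1. basis_vec (Inl t) a) * (\<Sum>t=0..n2. basis_vec (Inl t) b)
        * (\<Sum>t=0..n3. basis_vec (Inl t) c)"
    by (simp add: e1_def e2_def e3_def I_def mult.assoc
          sum_product_box[of "\<lambda>t. basis_vec (Inl t) a" "\<lambda>t. basis_vec (Inl t) b" "\<lambda>t. basis_vec (Inl t) c"])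
  have S1x: "(\<Sum>i\<in>I. X i * (e2 i * e3 i)) = 0"
    by (cases a rule: on_right_cases) (auto simp: defs intro!: first_order_term)
  have S1y: "(\<Sum>i\<in>I. Y i * (e1 i * e3 i)) = 0"
    by (cases b rule: on_right_cases) (auto simp: defs intro!: first_order_term)
  have S1z: "(\<Sum>i\<in>I. Z i * (e1 i * e2 i)) = 0"
    by (cases c rule: on_right_cases) (auto simp: defs intro!: first_order_term)
  have S2xy: "(\<Sum>i\<in>I. X i * Y i * e3 i) = 0"
    by (cases a rule: on_right_cases; cases b rule: on_right_cases) (auto simp: defs intro!: second_order_term)
  have S2xz: "(\<Sum>i\<in>I. X i * Z i * e2 i) = 0"
    by (cases a rule: on_right_cases; cases c rule: on_right_cases) (auto simp: defs intro!: second_order_term)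
  have S2yz: "(\<Sum>i\<in>I. Y i * Z i * e1 i) = 0"
    by (cases b rule: on_right_cases; cases c rule: on_right_cases) (auto simp: defs intro!: second_order_term)
  have S3: "(\<Sum>i\<in>I. X i * Y i * Z i)
      = (\<Sum>l=1..M. basis_vec (Inr l) a * basis_vec (Inr l) b * basis_vec (Inr l) c)"
  proof (cases "\<exists>l l' l''. a = Inr l \<and> b = Inr l' \<and> c = Inr l'' \<and> {l, l', l''} \<subseteq> {1..M}")
    case True
    then obtain l l' l'' where abc: "a = Inr l" "b = Inr l'" "c = Inr l''"
      and mem: "l \<in> {1..M}" "l' \<in> {1..M}" "l'' \<in> {1..M}" by auto
    have "(\<Sum>k=1..M. basis_vec (Inr k) a * basis_vec (Inr k) b * basis_vec (Inr k) c)
        = (\<Sum>k=1..M. of_bool (k = l) * of_bool (l = l' \<and> l = l''))"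
      by (rule sum.cong) (auto simp: abc basis_vec_def)
    also have "\<dots> = of_bool (l = l' \<and> l = l'')" using mem by (intro sum_of_bool_eq_mult) auto
    finally show ?thesis using third_order_term[OF mem] mem by (simp add: abc defs on_right_def)
  next
    case False
    have "X i * Y i * Z i = 0" for i
      using False by (auto simp: defs on_right_def split: sum.splits)
    moreover have "basis_vec (Inr l) a * basis_vec (Inr l) b * basis_vec (Inr l) c = 0"
      if "l \<in> {1..M}" for l
      using False that by (auto simp: basis_vec_def)
    ultimately show ?thesis by (simp only: sum.neutral_const cong: sum.cong)
  qed
  have "(\<Sum>i\<in>I. (e1 i + \<epsilon> * X i) * (e2 i + \<epsilon> * Y i) * (e3 i + \<epsilon> * Z i))
     = (\<Sum>i\<in>I. e1 i * e2 i * e3 i + \<epsilon> * (X i * (e2 i * e3 i)) + \<epsilon> * (Y i * (e1 i * e3 i))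
         + \<epsilon> * (Z i * (e1 i * e2 i)) + \<epsilon>\<^sup>2 * (X i * Y i * e3 i) + \<epsilon>\<^sup>2 * (X i * Z i * e2 i)
         + \<epsilon>\<^sup>2 * (Y i * Z i * e1 i) + \<epsilon> ^ 3 * (X i * Y i * Z i))"
    by (rule sum.cong) (simp_all add: algebra_simps power2_eq_square power3_eq_cube)
  also have "\<dots> = (\<Sum>i\<in>I. e1 i * e2 i * e3 i) + \<epsilon> ^ 3 * (\<Sum>i\<in>I. X i * Y i * Z i)"
    by (simp only: sum.distrib sum_distrib_left[symmetric] S1x S1y S1z S2xy S2xz S2yz
        mult_zero_right add_0_right)
  finally show ?thesis unfolding S0 S3 by (simp only: e1_def e2_def e3_def X_def Y_def Z_def)
qed

definition full_tensor :: "nat \<times> nat \<times> nat \<times> (nat \<times> nat \<times> nat) \<Rightarrow> complex" where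
  "full_tensor = (\<lambda>s. \<Sum>i\<in>I. pure_tensor (basis_vec (fst i)) (basis_vec (fst (snd i)))
                     (basis_vec (snd (snd i))) (basis_vec i) s)"

definition diagonal_tensor :: "nat \<times> nat \<times> nat \<times> unit \<Rightarrow> complex" where
  "diagonal_tensor = (\<lambda>s. \<Sum>l=1..M. pure_tensor (basis_vec l) (basis_vec l) (basis_vec l) (basis_vec ()) s)"

lemma tensor_dsum_full_diagonal:
  "tensor_dsum full_tensor diagonal_tensor (a, b, c, d)
    = (\<Sum>i\<in>I. basis_vec (Inl (fst i)) a * basis_vec (Inl (fst (snd i))) b
          * basis_vec (Inl (snd (snd i))) c * basis_vec (Inl i) d)
      + (\<Sum>l=1..M. basis_vec (Inr l) a * basis_vec (Inr l) b * basis_vec (Inr l) c)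
          * basis_vec (Inr ()) d"
  by (cases a; cases b; cases c; cases d)
    (simp_all add: tensor_dsum_def full_tensor_def diagonal_tensor_def pure_tensor_def sum_distrib_right)

text \<open>
  The last summand removes the constant term of \<open>expansion\<close>, which would diverge after division
  by \<open>\<epsilon> ^ 3\<close>.
\<close>

definition degeneration ::
  "complex \<Rightarrow> (nat + nat) \<times> (nat + nat) \<times> (nat + nat) \<times> ((nat \<times> nat \<times> nat) + unit) \<Rightarrow> complex"
  where "degeneration \<epsilon> s =
     (\<Sum>i\<in>I. pure_tensor (\<lambda>a. basis_vec (Inl (fst i)) a + \<epsilon> * on_right coeff1 i a)
          (\<lambda>b. basis_vec (Inl (fst (snd i))) b + \<epsilon> * on_right coeff2 i b)
          (\<lambda>c. basis_vec (Inl (snd (snd i))) c + \<epsilon> * on_right coeff3 i c)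
          (\<lambda>d. basis_vec (Inl i) d + inverse (\<epsilon> ^ 3) * basis_vec (Inr ()) d) s)
     + pure_tensor (\<lambda>a. \<Sum>t=0..n1. basis_vec (Inl t) a) (\<lambda>b. \<Sum>t=0..n2. basis_vec (Inl t) b)
         (\<lambda>c. \<Sum>t=0..n3. basis_vec (Inl t) c) (\<lambda>d. - inverse (\<epsilon> ^ 3) * basis_vec (Inr ()) d) s"

lemma degeneration_sum_of_pures:
  "sum_of_pures ({0..n1} <+> {1..M}) ({0..n2} <+> {1..M}) ({0..n3} <+> {1..M}) (I <+> {()})
     (card (I <+> {()})) (degeneration \<epsilon>)"
proof (rule sum_of_puresI)
  fix s
  show "degeneration \<epsilon> s = (\<Sum>k\<in>I <+> {()}. pure_tensor
     (case k of Inl i \<Rightarrow> \<lambda>a. basis_vec (Inl (fst i)) a + \<epsilon> * on_right coeff1 i a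
        | Inr _ \<Rightarrow> \<lambda>a. \<Sum>t=0..n1. basis_vec (Inl t) a)
     (case k of Inl i \<Rightarrow> \<lambda>b. basis_vec (Inl (fst (snd i))) b + \<epsilon> * on_right coeff2 i b
        | Inr _ \<Rightarrow> \<lambda>b. \<Sum>t=0..n2. basis_vec (Inl t) b)
     (case k of Inl i \<Rightarrow> \<lambda>c. basis_vec (Inl (snd (snd i))) c + \<epsilon> * on_right coeff3 i c
        | Inr _ \<Rightarrow> \<lambda>c. \<Sum>t=0..n3. basis_vec (Inl t) c)
     (case k of Inl i \<Rightarrow> \<lambda>d. basis_vec (Inl i) d + inverse (\<epsilon> ^ 3) * basis_vec (Inr ()) d
        | Inr _ \<Rightarrow> \<lambda>d. - inverse (\<epsilon> ^ 3) * basis_vec (Inr ()) d) s)"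
    by (simp add: degeneration_def sum.Plus)
qed (auto simp: coord_space_def basis_vec_def on_right_def I_def split: sum.splits intro!: sum.neutral)

text \<open>
  For \<open>\<epsilon> \<noteq> 0\<close> the coefficient of \<open>basis_vec (Inr ())\<close> in the fourth factor is that of the
  limit exactly; the coefficients of the \<open>basis_vec (Inl i)\<close> are polynomials in \<open>\<epsilon>\<close>.
\<close>

lemma degeneration_tendsto: "((\<lambda>\<epsilon>. degeneration \<epsilon> s) \<longlongrightarrow> tensor_dsum full_tensor diagonal_tensor s) (at 0)"
proof -
  obtain a b c d where s: "s = (a, b, c, d)" by (cases s)
  let ?P = "\<lambda>\<epsilon> i. (basis_vec (Inl (fst i)) a + \<epsilon> * on_right coeff1 i a)
        * (basis_vec (Inl (fst (snd i))) b + \<epsilon> * on_right coeff2 i b)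
        * (basis_vec (Inl (snd (snd i))) c + \<epsilon> * on_right coeff3 i c)"
  let ?W = "\<Sum>l=1..M. basis_vec (Inr l) a * basis_vec (Inr l) b * basis_vec (Inr l) c"
  have eq: "degeneration \<epsilon> s = (\<Sum>i\<in>I. ?P \<epsilon> i * basis_vec (Inl i) d) + ?W * basis_vec (Inr ()) d"
    if "\<epsilon> \<noteq> 0" for \<epsilon>
  proof -
    have "degeneration \<epsilon> s = (\<Sum>i\<in>I. ?P \<epsilon> i * basis_vec (Inl i) d)
       + inverse (\<epsilon> ^ 3) * basis_vec (Inr ()) d * ((\<Sum>i\<in>I. ?P \<epsilon> i)
           - (\<Sum>t=0..n1. basis_vec (Inl t) a) * (\<Sum>t=0..n2. basis_vec (Inl t) b)
              * (\<Sum>t=0..n3. basis_vec (Inl t) c))"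
      by (simp add: degeneration_def pure_tensor_def s distrib_left sum.distrib right_diff_distrib
            sum_distrib_left sum_negf mult_ac)
    then show ?thesis unfolding expansion using that by simp
  qed
  have "((\<lambda>\<epsilon>. (\<Sum>i\<in>I. ?P \<epsilon> i * basis_vec (Inl i) d) + ?W * basis_vec (Inr ()) d)
      \<longlongrightarrow> (\<Sum>i\<in>I. ?P 0 i * basis_vec (Inl i) d) + ?W * basis_vec (Inr ()) d) (at 0)"
    by (intro tendsto_intros)
  also have "(\<Sum>i\<in>I. ?P 0 i * basis_vec (Inl i) d) + ?W * basis_vec (Inr ()) d
      = tensor_dsum full_tensor diagonal_tensor s"
    by (simp add: s tensor_dsum_full_diagonal)
  finally show ?thesis
    by (rule Lim_transform_eventually) (auto simp: eq eventually_at_filter)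
qed

section \<open>The three border ranks\<close>

lemma full_tensor_entry:
  assumes "k \<in> I"
  shows "full_tensor (fst k, fst (snd k), snd (snd k), l) = of_bool (k = l)"
proof -
  have "full_tensor (fst k, fst (snd k), snd (snd k), l)
      = (\<Sum>i\<in>I. of_bool (i = k) * of_bool (k = l))"
    unfolding full_tensor_def
    by (rule sum.cong) (auto simp: pure_tensor_def basis_vec_def prod_eq_iff)
  with assms show ?thesis by (simp add: sum_of_bool_eq_mult)
qed

lemma diagonal_tensor_entry:
  assumes "k \<in> {1..M}"
  shows "diagonal_tensor (k, l, l, ()) = of_bool (k = l)"
proof -
  have "diagonal_tensor (k, l, l, ()) = (\<Sum>i=1..M. of_bool (i = k) * of_bool (k = l))"
    unfolding diagonal_tensor_def by (rule sum.cong) (auto simp: pure_tensor_def basis_vec_def)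
  with assms show ?thesis by (simp add: sum_of_bool_eq_mult)
qed

lemma border_rank_full: "border_rank {0..n1} {0..n2} {0..n3} I full_tensor = card I"
proof (rule border_rank_eqI[where F = "\<lambda>_. full_tensor" and
      \<sigma> = "\<lambda>k l. (fst k, fst (snd k), snd (snd k), l)"])
  show "separates_modes (\<lambda>k l :: nat \<times> nat \<times> nat. (fst k, fst (snd k), snd (snd k), l))"
    by (rule separates_modes_last)
  show "full_tensor (fst k, fst (snd k), snd (snd k), l) = of_bool (k = l)" if "k \<in> I" for k l
    using that by (rule full_tensor_entry)
next
  show "sum_of_pures {0..n1} {0..n2} {0..n3} I (card I) full_tensor"
    by (rule sum_of_puresI[OF finite_I]) (auto simp: full_tensor_def I_def)
qed auto

lemma border_rank_diagonal: "border_rank {1..M} {1..M} {1..M} {()} diagonal_tensor = M"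
proof -
  have "border_rank {1..M} {1..M} {1..M} {()} diagonal_tensor = card {1..M}"
  proof (rule border_rank_eqI[where F = "\<lambda>_. diagonal_tensor" and \<sigma> = "\<lambda>k l. (k, l, l, ())"])
    show "separates_modes (\<lambda>k l :: nat. (k, l, l, ()))"
      by (rule separates_modes_first)
    show "diagonal_tensor (k, l, l, ()) = of_bool (k = l)" if "k \<in> {1..M}" for k l
      using that by (rule diagonal_tensor_entry)
  next
    show "sum_of_pures {1..M} {1..M} {1..M} {()} (card {1..M}) diagonal_tensor"
      by (rule sum_of_puresI) (auto simp: diagonal_tensor_def)
  qed auto
  then show ?thesis by simp
qed

lemma border_rank_dsum:
  assumes "M \<ge> 1"
  shows "border_rank ({0..n1} <+> {1..M}) ({0..n2} <+> {1..M}) ({0..n3} <+> {1..M}) (I <+> {()})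
     (tensor_dsum full_tensor diagonal_tensor) = card I + 1"
proof -
  (* Rows of the identity block: the box for the full tensor, and the position (1, 1, 1) of the
     diagonal tensor, which exists because M is positive. *)
  define r :: "(nat \<times> nat \<times> nat) + unit \<Rightarrow> (nat + nat) \<times> (nat + nat) \<times> (nat + nat)" where
    "r k = (case k of Inl i \<Rightarrow> (Inl (fst i), Inl (fst (snd i)), Inl (snd (snd i)))
              | Inr _ \<Rightarrow> (Inr 1, Inr 1, Inr 1))" for k
  have "border_rank ({0..n1} <+> {1..M}) ({0..n2} <+> {1..M}) ({0..n3} <+> {1..M}) (I <+> {()})
     (tensor_dsum full_tensor diagonal_tensor) = card (I <+> {()})"
  proof (rule border_rank_eqI[where F = degeneration and
      \<sigma> = "\<lambda>k l. (fst (r k), fst (snd (r k)), snd (snd (r k)), l)"])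
    show "separates_modes (\<lambda>k l. (fst (r k), fst (snd (r k)), snd (snd (r k)), l))"
      by (rule separates_modes_last)
    fix k l :: "(nat \<times> nat \<times> nat) + unit" assume kl: "k \<in> I <+> {()}" "l \<in> I <+> {()}"
    show "tensor_dsum full_tensor diagonal_tensor (fst (r k), fst (snd (r k)), snd (snd (r k)), l)
        = of_bool (k = l)"
      using kl assms full_tensor_entry diagonal_tensor_entry[of 1 1]
      by (auto simp: tensor_dsum_def r_def)
  next
    fix \<epsilon> show "sum_of_pures ({0..n1} <+> {1..M}) ({0..n2} <+> {1..M}) ({0..n3} <+> {1..M})
      (I <+> {()}) (card (I <+> {()})) (degeneration \<epsilon>)" by (rule degeneration_sum_of_pures)
  qed (auto intro: degeneration_tendsto)
  then show ?thesis by (simp add: card_Plus)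
qed

end

lemma admissible_max_admissible: "admissible n1 n2 n3 (max_admissible n1 n2 n3)"
  unfolding max_admissible_def
proof (rule GreatestI_nat)
  show "admissible n1 n2 n3 0"
    unfolding admissible_def by (intro exI[of _ "{}"]) (auto simp: bij_betw_def)
  fix m assume "admissible n1 n2 n3 m"
  then obtain J where "J \<subseteq> {1..n1} \<times> {1..n2} \<times> {1..n3}" "card J = m"
    unfolding admissible_def by blast
  then show "m \<le> card ({1..n1} \<times> {1..n2} \<times> {1..n3})"
    by (metis card_mono finite_SigmaI finite_atLeastAtMost)
qed

lemma disjoint_matched_points_if_admissible:
  assumes "admissible n1 n2 n3 M"
  obtains p q1 q2 q3 where "disjoint_matched_points n1 n2 n3 M p q1 q2 q3"
proof -
  let ?B = "{1..n1} \<times> {1..n2} \<times> {1..n3}"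
  from assms obtain J K1 K2 K3 s1 s2 s3 where
    sub: "J \<subseteq> ?B" "K1 \<subseteq> ?B" "K2 \<subseteq> ?B" "K3 \<subseteq> ?B" and
    dis: "J \<inter> K1 = {}" "J \<inter> K2 = {}" "J \<inter> K3 = {}" "K1 \<inter> K2 = {}" "K1 \<inter> K3 = {}" "K2 \<inter> K3 = {}" and
    "card J = M" and
    s: "bij_betw s1 J K1" "bij_betw s2 J K2" "bij_betw s3 J K3" and
    agree: "\<forall>j\<in>J. fst (s1 j) = fst j" "\<forall>j\<in>J. fst (snd (s2 j)) = fst (snd j)"
       "\<forall>j\<in>J. snd (snd (s3 j)) = snd (snd j)"
    unfolding admissible_def by (elim exE conjE) (rule that)
  have "finite J" using sub(1) by (rule finite_subset) simp
  then obtain p where p: "bij_betw p {1..M} J"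
    using ex_bij_betw_nat_finite_1 \<open>card J = M\<close> by blast
  note b = p bij_betw_trans[OF p s(1)] bij_betw_trans[OF p s(2)] bij_betw_trans[OF p s(3)]
  note mem = b[THEN bij_betwE, rule_format]
  show ?thesis
  proof (rule that, unfold_locales)
    show "inj_on p {1..M}" "inj_on (s1 \<circ> p) {1..M}" "inj_on (s2 \<circ> p) {1..M}" "inj_on (s3 \<circ> p) {1..M}"
      using b by (simp_all add: bij_betw_def)
  next
    fix l assume l: "l \<in> {1..M}"
    show "{p l, (s1 \<circ> p) l, (s2 \<circ> p) l, (s3 \<circ> p) l} \<subseteq> ?B"
      using mem[OF l] sub by blast
    show "fst ((s1 \<circ> p) l) = fst (p l)" "fst (snd ((s2 \<circ> p) l)) = fst (snd (p l))"
      "snd (snd ((s3 \<circ> p) l)) = snd (snd (p l))"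
      using agree mem(1)[OF l] by auto
    fix l' assume l': "l' \<in> {1..M}"
    show "p l \<noteq> (s1 \<circ> p) l' \<and> p l \<noteq> (s2 \<circ> p) l' \<and> p l \<noteq> (s3 \<circ> p) l' \<and>
      (s1 \<circ> p) l \<noteq> (s2 \<circ> p) l' \<and> (s1 \<circ> p) l \<noteq> (s3 \<circ> p) l' \<and> (s2 \<circ> p) l \<noteq> (s3 \<circ> p) l'"
      using mem[OF l] mem[OF l'] dis by (metis disjoint_iff)
  qed
qed

theorem theorem3p5:
  fixes n1 n2 n3 M :: nat
    and T1 :: "nat \<times> nat \<times> nat \<times> (nat \<times> nat \<times> nat) \<Rightarrow> complex"
    and T2 :: "nat \<times> nat \<times> nat \<times> unit \<Rightarrow> complex"
  assumes "n1 \<ge> 1" and "n2 \<ge> 1" and "n3 \<ge> 1"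
    and "M = max_admissible n1 n2 n3" and "M \<ge> 1"
    and "T1 = (\<lambda>x. \<Sum>i1=0..n1. \<Sum>i2=0..n2. \<Sum>i3=0..n3.
           pure_tensor (basis_vec i1) (basis_vec i2) (basis_vec i3) (basis_vec (i1, i2, i3)) x)"
    and "T2 = (\<lambda>x. \<Sum>l=1..M.
           pure_tensor (basis_vec l) (basis_vec l) (basis_vec l) (basis_vec ()) x)"
  shows "border_rank {0..n1} {0..n2} {0..n3} ({0..n1} \<times> {0..n2} \<times> {0..n3}) T1
           = (n1 + 1) * (n2 + 1) * (n3 + 1) \<and>
         border_rank {1..M} {1..M} {1..M} {()} T2 = M \<and>
         border_rank ({0..n1} <+> {1..M}) ({0..n2} <+> {1..M}) ({0..n3} <+> {1..M})
             (({0..n1} \<times> {0..n2} \<times> {0..n3}) <+> {()}) (tensor_dsum T1 T2)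
           = (n1 + 1) * (n2 + 1) * (n3 + 1) + 1"
proof -
  have "admissible n1 n2 n3 M" unfolding assms(4) by (rule admissible_max_admissible)
  then obtain p q1 q2 q3 where "disjoint_matched_points n1 n2 n3 M p q1 q2 q3"
    by (rule disjoint_matched_points_if_admissible)
  then interpret disjoint_matched_points n1 n2 n3 M p q1 q2 q3 .
  have "T1 = full_tensor"
    unfolding assms(6) full_tensor_def I_def by (simp add: sum.cartesian_product split_def)
  moreover have "T2 = diagonal_tensor"
    unfolding assms(7) diagonal_tensor_def ..
  ultimately show ?thesis
    using border_rank_full border_rank_diagonal border_rank_dsum[OF assms(5)] card_I by (simp add: I_def)
qed

end
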